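(* Let $X=\{x_1,\ldots,x_n\}$, let $I\subset\mathbb{Z}[X]$ be a monomial ideal containing $x_1^2,\ldots,x_n^2$, let $a,b\in X$ with $a$ dominating $b$ in $I$, and let $b'$ be a new variable and $I'=(I,ab',(b')^2)\subset\mathbb{Z}[X][b']$. Then (1) $R(I')$ collapses onto $R(I)$; (2) $R(I)$ collapses onto $\Sigma_{a,b}\bigl(R(I:a)\bigr)$; (3) $R(I')$ collapses onto $\Sigma_{a,b'}\bigl(R(I':a)\bigr)$. In particular $R(I)$ is simple-homotopic to the suspension $\Sigma\bigl(R(I:a)\bigr)$.
   Context: $R(I)$ is the simplicial complex whose faces are the monomials not in $I$ (square-free monomials identified with sets of variables). $(I:x)=\{m:xm\in I\}$, $(I,x)$ the ideal generated by $I$ and $x$. $R(I)$ is a cone with apex $c\in X$ if $(I:c)=(I,c)$, i.e. $c$ divides no minimal monomial generator of $I$ other than the squares of variables. $a$ dominates $b$ in $I$ if $R(I)$ is not a cone with apex $b$ but $R((I,a))$ is a cone with apex $b$. For a complex $\Delta$ and variables $x\neq y$, $\Sigma_{x,y}(\Delta)=\{\mathrm{lcm}(m,u): m\in\Delta, u\in\{1,x,y\}\}$; when $x,y$ divide no face of $\Delta$ this is the suspension $\Sigma(\Delta)$. An elementary collapse removes a maximal face $\sigma$ and a face $\tau\subset\sigma$ with $\deg\tau=\deg\sigma-1$ such that $\sigma$ is the only face properly containing $\tau$; $\Delta$ collapses onto a subcomplex $\Delta'$ if $\Delta'$ is reached by a sequence of elementary collapses; simple-homotopy is the equivalence relation generated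 by elementary collapses. *)

theory Defs
  imports "HOL-Library.Poly_Mapping" "HOL-Algebra.Ideal"
begin

type_synonym 'v mono = "'v \<Rightarrow>\<^sub>0 nat"
type_synonym 'v zpoly = "'v mono \<Rightarrow>\<^sub>0 int"

definition mpoly :: "'v mono \<Rightarrow> 'v zpoly" where
  "mpoly m = Poly_Mapping.single m 1"

definition var :: "'v \<Rightarrow> 'v zpoly" where
  "var x = mpoly (Poly_Mapping.single x 1)"

definition monomials :: "'v set \<Rightarrow> 'v mono set" where
  "monomials X = {m. Poly_Mapping.keys m \<subseteq> X}"

definition zpoly_ring :: "'v set \<Rightarrow> 'v zpoly ring" where
  "zpoly_ring X = \<lparr>carrier = {p. Poly_Mapping.keys p \<subseteq> monomials X},
     monoid.mult = (*), one = 1, zero = 0, add = (+)\<rparr>"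

lemma cring_zpoly_ring: "cring (zpoly_ring X)"
proof (rule cringI)
  have m: "p * q \<in> {p. Poly_Mapping.keys p \<subseteq> monomials X}"
    if "Poly_Mapping.keys p \<subseteq> monomials X" "Poly_Mapping.keys q \<subseteq> monomials X" for p q :: "'a zpoly"
  proof -
    have "i + j \<in> monomials X" if "i \<in> monomials X" "j \<in> monomials X" for i j :: "'a mono"
      using that Poly_Mapping.keys_add[of i j] unfolding monomials_def by blast
    then show ?thesis
      using that keys_mult[of p q] by blast
  qed
  show "abelian_group (zpoly_ring X)"
  proof (rule abelian_groupI)
    fix p q assume "p \<in> carrier (zpoly_ring X)" "q \<in> carrier (zpoly_ring X)"
    then show "p \<oplus>\<^bsub>zpoly_ring X\<^esub> q \<in> carrier (zpoly_ring X)"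
      using Poly_Mapping.keys_add[of p q] by (auto simp: zpoly_ring_def)
  next
    fix p assume "p \<in> carrier (zpoly_ring X)"
    then show "\<exists>q\<in>carrier (zpoly_ring X). q \<oplus>\<^bsub>zpoly_ring X\<^esub> p = \<zero>\<^bsub>zpoly_ring X\<^esub>"
      by (intro bexI[of _ "- p"]) (auto simp: zpoly_ring_def)
  qed (auto simp: zpoly_ring_def algebra_simps)
  show "comm_monoid (zpoly_ring X)"
    using m by (intro comm_monoidI) (auto simp: zpoly_ring_def monomials_def algebra_simps)
qed (auto simp: zpoly_ring_def algebra_simps)

definition monomial_ideal :: "'v set \<Rightarrow> 'v zpoly set \<Rightarrow> bool" where
  "monomial_ideal X I \<longleftrightarrow> (\<exists>G \<subseteq> monomials X. I = genideal (zpoly_ring X) (mpoly ` G))"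

text \<open>\<open>ideal_adjoin X I S\<close> is the ideal \<open>(I, S)\<close> of \<open>\<int>[X]\<close>, and
  \<open>ideal_colon X I x\<close> is the ideal \<open>(I : x)\<close> of \<open>\<int>[X]\<close>.\<close>

definition ideal_adjoin :: "'v set \<Rightarrow> 'v zpoly set \<Rightarrow> 'v zpoly set \<Rightarrow> 'v zpoly set" where
  "ideal_adjoin X I S = genideal (zpoly_ring X) (I \<union> S)"

definition ideal_colon :: "'v set \<Rightarrow> 'v zpoly set \<Rightarrow> 'v \<Rightarrow> 'v zpoly set" where
  "ideal_colon X I x = {p \<in> carrier (zpoly_ring X). var x * p \<in> I}"

text \<open>The faces of \<open>R(I)\<close> are the monomials of \<open>\<int>[X]\<close> outside \<open>I\<close>. When \<open>I\<close>
  contains the squares of all variables these are square-free, so that a monomial is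
  determined by the set \<open>keys m\<close> of variables dividing it; a face is represented by that set.
  Degree becomes cardinality, divisibility becomes inclusion, lcm becomes union.\<close>

definition R :: "'v set \<Rightarrow> 'v zpoly set \<Rightarrow> 'v set set" where
  "R X I = Poly_Mapping.keys ` {m \<in> monomials X. mpoly m \<notin> I}"

definition is_cone :: "'v set \<Rightarrow> 'v zpoly set \<Rightarrow> 'v \<Rightarrow> bool" where
  "is_cone X I c \<longleftrightarrow> ideal_colon X I c = ideal_adjoin X I {var c}"

definition dominates :: "'v set \<Rightarrow> 'v zpoly set \<Rightarrow> 'v \<Rightarrow> 'v \<Rightarrow> bool" where
  "dominates X I a b \<longleftrightarrow> \<not> is_cone X I b \<and> is_cone X (ideal_adjoin X I {var a}) b"

definition susp :: "'v \<Rightarrow> 'v \<Rightarrow> 'v set set \<Rightarrow> 'v set set" where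
  "susp x y \<Delta> = {m \<union> u | m u. m \<in> \<Delta> \<and> u \<in> {{}, {x}, {y}}}"

text \<open>Finite abstract simplicial complexes; a nonvoid complex has the empty face
  (the monomial \<open>1\<close>) as a face.\<close>

definition simplicial_complex :: "'v set set \<Rightarrow> bool" where
  "simplicial_complex \<Delta> \<longleftrightarrow>
     finite \<Delta> \<and> (\<forall>\<sigma>\<in>\<Delta>. finite \<sigma>) \<and> (\<forall>\<sigma>\<in>\<Delta>. \<forall>\<tau>. \<tau> \<subseteq> \<sigma> \<longrightarrow> \<tau> \<in> \<Delta>)"

definition elementary_collapse :: "'v set set \<Rightarrow> 'v set set \<Rightarrow> bool" where
  "elementary_collapse \<Delta> \<Delta>' \<longleftrightarrow> simplicial_complex \<Delta> \<and>
     (\<exists>\<sigma>\<in>\<Delta>. \<exists>\<tau>\<in>\<Delta>. (\<forall>\<rho>\<in>\<Delta>. \<not> \<sigma> \<subset> \<rho>) \<and> \<tau> \<subset> \<sigma> \<and> card \<sigma> = card \<tau> + 1 \<and>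
        (\<forall>\<rho>\<in>\<Delta>. \<tau> \<subset> \<rho> \<longrightarrow> \<rho> = \<sigma>) \<and> \<Delta>' = \<Delta> - {\<sigma>, \<tau>})"

definition collapses_onto :: "'v set set \<Rightarrow> 'v set set \<Rightarrow> bool" where
  "collapses_onto \<Delta> \<Delta>' \<longleftrightarrow> simplicial_complex \<Delta> \<and> elementary_collapse\<^sup>*\<^sup>* \<Delta> \<Delta>'"

definition simple_homotopic :: "'v set set \<Rightarrow> 'v set set \<Rightarrow> bool" where
  "simple_homotopic \<Delta> \<Delta>' \<longleftrightarrow>
     simplicial_complex \<Delta> \<and> simplicial_complex \<Delta>' \<and> equivclp elementary_collapse \<Delta> \<Delta>'"

end

theory Submission
  imports Defs
begin

text \<open>If \<open>K'\<close> is a subcomplex of \<open>K\<close> and the set \<open>K - K'\<close> is closed under adding and removing one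
  fixed vertex \<open>b\<close>, then \<open>K\<close> collapses onto \<open>K'\<close>: a face of \<open>K - K'\<close> of largest cardinality
  contains \<open>b\<close>, and can be removed together with the face obtained by deleting \<open>b\<close>.
  Domination of \<open>b\<close> by \<open>a\<close> says that the faces avoiding \<open>a\<close> form a cone with apex \<open>b\<close>, and all three
  collapses are of this kind: (1) and (2) by toggling \<open>b\<close>, and (3) by toggling \<open>b'\<close>, as it is the
  instance of (2) for \<open>b'\<close>, which is dominated by \<open>a\<close> in \<open>I'\<close>.
  Since \<open>R(I' : a) = R(I : a)\<close> does not involve \<open>a\<close> or \<open>b'\<close>, (1) and (3) show that
  \<open>R(I)\<close> is simple-homotopic to a genuine suspension of \<open>R(I : a)\<close>.
  Two suspensions that differ in one suspension vertex are collapses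
  of a common complex, in which the two competing vertices span an edge.\<close>

section \<open>Collapses\<close>

lemma simplicial_complexD:
  assumes "simplicial_complex K" "\<sigma> \<in> K" "\<tau> \<subseteq> \<sigma>"
  shows "\<tau> \<in> K"
  using assms unfolding simplicial_complex_def by blast

lemma simplicial_complex_finite:
  assumes "simplicial_complex K"
  shows "finite K" and "\<And>\<sigma>. \<sigma> \<in> K \<Longrightarrow> finite \<sigma>"
  using assms[unfolded simplicial_complex_def, THEN conjunct1]
    assms[unfolded simplicial_complex_def, THEN conjunct2, THEN conjunct1] by blast+

text \<open>The last two hypotheses are completed by closure under subsets: adding \<open>b\<close>
  cannot lead into \<open>K'\<close>, and removing \<open>b\<close> cannot leave \<open>K\<close>.
  So toggling \<open>b\<close> pairs up the faces of \<open>K - K'\<close>; the induction removes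
  one pair at a time.\<close>

lemma collapses_onto_by_toggling:
  assumes "simplicial_complex K" "simplicial_complex K'" "K' \<subseteq> K"
    and "\<And>\<sigma>. \<sigma> \<in> K \<Longrightarrow> \<sigma> \<notin> K' \<Longrightarrow> insert b \<sigma> \<in> K"
    and "\<And>\<sigma>. \<sigma> \<in> K \<Longrightarrow> \<sigma> \<notin> K' \<Longrightarrow> \<sigma> - {b} \<notin> K'"
  shows "collapses_onto K K'"
  using assms
proof (induction "card (K - K')" arbitrary: K rule: less_induct)
  case less
  have fin: "finite K" and finf: "\<And>\<sigma>. \<sigma> \<in> K \<Longrightarrow> finite \<sigma>"
    using simplicial_complex_finite[OF less.prems(1)] by auto
  show ?case
  proof (cases "K = K'")
    case True
    then show ?thesis using less.prems(1) by (simp add: collapses_onto_def)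
  next
    case False
    then have "K - K' \<noteq> {}" using less.prems(3) by blast
    moreover have "finite (K - K')" using fin by simp
    ultimately have "Max (card ` (K - K')) \<in> card ` (K - K')"
      and "\<And>\<rho>. \<rho> \<in> K - K' \<Longrightarrow> card \<rho> \<le> Max (card ` (K - K'))"
      by auto
    then obtain \<sigma> where \<sigma>: "\<sigma> \<in> K - K'"
      and max: "\<And>\<rho>. \<rho> \<in> K - K' \<Longrightarrow> card \<rho> \<le> card \<sigma>"
      by (metis (no_types, lifting) imageE)
    have ins: "insert b \<rho> \<in> K - K'" if "\<rho> \<in> K" "\<rho> \<notin> K'" for \<rho>
      using less.prems(4)[OF that] that simplicial_complexD[OF less.prems(2)] by blast
    have b: "b \<in> \<sigma>"
    proof (rule ccontr)
      assume "b \<notin> \<sigma>"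
      then have "card (insert b \<sigma>) = Suc (card \<sigma>)" using \<sigma> finf by auto
      then show False using max[OF ins, of \<sigma>] \<sigma> by auto
    qed
    define \<tau> where "\<tau> = \<sigma> - {b}"
    have \<tau>: "\<tau> \<in> K" "\<tau> \<notin> K'" "\<tau> \<subset> \<sigma>" "insert b \<tau> = \<sigma>"
      using \<sigma> b less.prems(5) simplicial_complexD[OF less.prems(1)] by (auto simp: \<tau>_def)
    \<comment> \<open>A face properly containing \<open>\<tau>\<close> is outside \<open>K'\<close>,
      and adding \<open>b\<close> to it gives a face that contains \<open>\<sigma>\<close> and is no
      larger, hence is \<open>\<sigma>\<close>. It already contained \<open>b\<close>, since
      otherwise it would equal \<open>\<tau>\<close>.\<close>
    have uniq: "\<rho> = \<sigma>" if "\<rho> \<in> K" "\<tau> \<subset> \<rho>" for \<rho>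
    proof -
      have "\<rho> \<notin> K'" using that \<tau> simplicial_complexD[OF less.prems(2)] by blast
      then have "card (insert b \<rho>) \<le> card \<sigma>" using max ins that by blast
      moreover have "\<sigma> \<subseteq> insert b \<rho>" using that \<tau> by blast
      moreover have "finite (insert b \<rho>)" using finf that by simp
      ultimately have "insert b \<rho> = \<sigma>" by (metis card_seteq)
      moreover from this have "b \<in> \<rho>" using that(2) by (auto simp: \<tau>_def)
      ultimately show ?thesis by blast
    qed
    have maximal: "\<not> \<sigma> \<subset> \<rho>" if "\<rho> \<in> K" for \<rho> using uniq[OF that] \<tau>(3) by blast
    define L where "L = K - {\<sigma>, \<tau>}"
    have "card \<sigma> = card \<tau> + 1" using card.remove[of \<sigma> b] b \<sigma> finf[of \<sigma>] by (simp add: \<tau>_def)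
    then have el: "elementary_collapse K L"
      unfolding elementary_collapse_def
      using less.prems(1) \<sigma> \<tau>(1,3) uniq maximal
      by (intro conjI bexI[of _ \<sigma>] bexI[of _ \<tau>] ballI impI L_def) auto
    have "simplicial_complex L"
      unfolding simplicial_complex_def
    proof (intro conjI ballI allI impI)
      fix \<rho> \<rho>' assume "\<rho> \<in> L" "\<rho>' \<subseteq> \<rho>"
      then show "\<rho>' \<in> L"
        using simplicial_complexD[OF less.prems(1)] uniq maximal unfolding L_def by blast
    qed (use fin finf in \<open>auto simp: L_def\<close>)
    moreover have "card (L - K') < card (K - K')"
      using \<sigma> fin by (intro psubset_card_mono) (auto simp: L_def)
    moreover have "K' \<subseteq> L" using less.prems(3) \<sigma> \<tau> by (auto simp: L_def)
    \<comment> \<open>The removed pair is closed under toggling: adding \<open>b\<close> produces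
      \<open>\<sigma>\<close> only from \<open>\<sigma>\<close> or \<open>\<tau>\<close>, and never
      produces \<open>\<tau>\<close>.\<close>
    moreover have "insert b \<rho> \<in> L" if "\<rho> \<in> L" "\<rho> \<notin> K'" for \<rho>
    proof -
      have "insert b \<rho> \<noteq> \<sigma>"
        using that b unfolding L_def \<tau>_def by auto
      moreover have "insert b \<rho> \<noteq> \<tau>" by (auto simp: \<tau>_def)
      ultimately show ?thesis using that less.prems(4) by (auto simp: L_def)
    qed
    moreover have "\<rho> - {b} \<notin> K'" if "\<rho> \<in> L" "\<rho> \<notin> K'" for \<rho>
      using that less.prems(5) by (auto simp: L_def)
    ultimately have "collapses_onto L K'"
      using less.hyps less.prems(2) by blast
    then show ?thesis
      using el less.prems(1) unfolding collapses_onto_def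
      by (meson converse_rtranclp_into_rtranclp)
  qed
qed

section \<open>Links and suspensions\<close>

text \<open>The combinatorial counterpart of the colon ideal by \<open>a\<close>: once
  \<open>a^2\<close> lies in the ideal, the faces of the colon complex avoid
  \<open>a\<close>.\<close>

definition link :: "'v \<Rightarrow> 'v set set \<Rightarrow> 'v set set" where
  "link a \<Delta> = {F. a \<notin> F \<and> insert a F \<in> \<Delta>}"

lemma mem_susp_iff:
  "G \<in> susp x y \<Delta> \<longleftrightarrow> G \<in> \<Delta> \<or> (\<exists>F\<in>\<Delta>. G = insert x F \<or> G = insert y F)"
proof -
  have "G \<in> susp x y \<Delta> \<longleftrightarrow> (\<exists>m\<in>\<Delta>. G = m \<union> {} \<or> G = m \<union> {x} \<or> G = m \<union> {y})"
    unfolding susp_def by blast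
  then show ?thesis unfolding Un_empty_right Un_insert_right by blast
qed

lemma susp_commute: "susp x y \<Delta> = susp y x \<Delta>"
  unfolding set_eq_iff mem_susp_iff by blast

text \<open>This is the cone over \<Delta> with apex \<open>x\<close>: deleting \<open>x\<close>
  from a subset of any of its faces leaves a face of \<Delta>.\<close>

lemma simplicial_complex_insert_image:
  assumes "simplicial_complex \<Delta>"
  shows "simplicial_complex (\<Delta> \<union> insert x ` \<Delta>)"
  unfolding simplicial_complex_def
proof (intro conjI ballI allI impI)
  fix \<sigma> \<tau> assume s: "\<sigma> \<in> \<Delta> \<union> insert x ` \<Delta>" "\<tau> \<subseteq> \<sigma>"
  then have "\<tau> - {x} \<in> \<Delta>"
    using simplicial_complexD[OF assms] by blast
  then show "\<tau> \<in> \<Delta> \<union> insert x ` \<Delta>"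
  proof (cases "x \<in> \<tau>")
    case True
    then have "\<tau> = insert x (\<tau> - {x})" by blast
    then show ?thesis using \<open>\<tau> - {x} \<in> \<Delta>\<close> by blast
  qed simp
qed (use simplicial_complex_finite[OF assms] in auto)

lemma simplicial_complex_Un:
  assumes "simplicial_complex K" "simplicial_complex L"
  shows "simplicial_complex (K \<union> L)"
  unfolding simplicial_complex_def
proof (intro conjI ballI allI impI)
  fix \<sigma> \<tau> assume "\<sigma> \<in> K \<union> L" "\<tau> \<subseteq> \<sigma>"
  then show "\<tau> \<in> K \<union> L"
    using simplicial_complexD[OF assms(1)] simplicial_complexD[OF assms(2)] by blast
qed (use assms[THEN simplicial_complex_finite(1)] assms[THEN simplicial_complex_finite(2)] in auto)

text \<open>The suspension is the union of two cones over the same base.\<close>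

lemma simplicial_complex_susp:
  assumes "simplicial_complex \<Delta>"
  shows "simplicial_complex (susp x y \<Delta>)"
proof -
  have "susp x y \<Delta> = (\<Delta> \<union> insert x ` \<Delta>) \<union> (\<Delta> \<union> insert y ` \<Delta>)"
    by (auto simp: mem_susp_iff)
  then show ?thesis
    using assms simplicial_complex_insert_image simplicial_complex_Un by metis
qed

section \<open>Links and the collapses obtained when a deletion is a cone\<close>

lemma simplicial_complex_link:
  assumes "simplicial_complex \<Delta>"
  shows "simplicial_complex (link a \<Delta>)"
proof -
  have "link a \<Delta> \<subseteq> \<Delta>"
    using simplicial_complexD[OF assms] by (auto simp: link_def)
  moreover have "\<tau> \<in> link a \<Delta>" if "\<sigma> \<in> link a \<Delta>" "\<tau> \<subseteq> \<sigma>" for \<sigma> \<tau>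
    using that simplicial_complexD[OF assms, of "insert a \<sigma>" "insert a \<tau>"] by (auto simp: link_def)
  ultimately show ?thesis
    using assms finite_subset unfolding simplicial_complex_def by blast
qed

text \<open>Every face containing \<open>a\<close> lies in the cone with apex \<open>a\<close> over
  its link. Only faces avoiding \<open>a\<close> have to be collapsed, and on these
  \<open>cone\<close> allows toggling \<open>b\<close>.\<close>

lemma collapses_onto_susp_link:
  assumes "simplicial_complex \<Delta>"
    and cone: "\<And>F. F \<in> \<Delta> \<Longrightarrow> a \<notin> F \<Longrightarrow> insert b F \<in> \<Delta> \<and> a \<notin> insert b F"
  shows "collapses_onto \<Delta> (susp a b (link a \<Delta>))"
proof (rule collapses_onto_by_toggling[where b = b])
  note down = simplicial_complexD[OF assms(1)]
  show "simplicial_complex (susp a b (link a \<Delta>))"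
    by (intro simplicial_complex_susp simplicial_complex_link assms(1))
  show "susp a b (link a \<Delta>) \<subseteq> \<Delta>"
  proof
    fix G assume "G \<in> susp a b (link a \<Delta>)"
    then obtain F where F: "a \<notin> F" "insert a F \<in> \<Delta>" "G = F \<or> G = insert a F \<or> G = insert b F"
      by (auto simp: mem_susp_iff link_def)
    then have "F \<in> \<Delta>" using down by blast
    then show "G \<in> \<Delta>" using F cone by auto
  qed
  fix \<sigma> assume \<sigma>: "\<sigma> \<in> \<Delta>" "\<sigma> \<notin> susp a b (link a \<Delta>)"
  have a: "a \<notin> \<sigma>"
  proof
    assume "a \<in> \<sigma>"
    then have "\<sigma> - {a} \<in> link a \<Delta>" "\<sigma> = insert a (\<sigma> - {a})"
      using \<sigma> by (auto simp: link_def insert_absorb)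
    then show False using \<sigma> unfolding mem_susp_iff by blast
  qed
  then show "insert b \<sigma> \<in> \<Delta>" using cone \<sigma> by blast
  show "\<sigma> - {b} \<notin> susp a b (link a \<Delta>)"
  proof
    assume "\<sigma> - {b} \<in> susp a b (link a \<Delta>)"
    \<comment> \<open>A face of the suspension that contains neither \<open>a\<close> nor
      \<open>b\<close> lies in the link, and putting \<open>b\<close> back keeps it in the
      suspension.\<close>
    then have "\<sigma> - {b} \<in> link a \<Delta>"
      using a cone[OF \<sigma>(1) a] unfolding mem_susp_iff by auto
    moreover have "\<sigma> = \<sigma> - {b} \<or> \<sigma> = insert b (\<sigma> - {b})" by blast
    ultimately show False using \<sigma>(2) unfolding mem_susp_iff by metis
  qed
qed (fact assms(1))

text \<open>The added faces form a cone with apex \<open>b'\<close> over the deletion of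
  \<open>a\<close>. That deletion is itself a cone with apex \<open>b\<close>, so toggling
  \<open>b\<close> preserves the added faces.\<close>

lemma collapses_onto_cone_over_deletion:
  assumes "simplicial_complex \<Delta>" "simplicial_complex \<Delta>'"
    and \<Delta>': "\<Delta>' = \<Delta> \<union> insert b' ` {F \<in> \<Delta>. a \<notin> F}"
    and b': "b' \<notin> \<Union> \<Delta>"
    and cone: "\<And>F. F \<in> \<Delta> \<Longrightarrow> a \<notin> F \<Longrightarrow> insert b F \<in> \<Delta> \<and> a \<notin> insert b F"
  shows "collapses_onto \<Delta>' \<Delta>"
proof (rule collapses_onto_by_toggling[where b = b])
  fix \<sigma> assume "\<sigma> \<in> \<Delta>'" "\<sigma> \<notin> \<Delta>"
  then obtain F where F: "\<sigma> = insert b' F" "F \<in> \<Delta>" "a \<notin> F" using \<Delta>' by blast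
  then have "insert b \<sigma> = insert b' (insert b F)" by blast
  then show "insert b \<sigma> \<in> \<Delta>'" using cone F \<Delta>' by blast
  \<comment> \<open>\<open>b\<close> is a vertex of \<Delta> because \<open>insert b F\<close> is a
    face, whereas \<open>b'\<close> is not a vertex.\<close>
  have "b \<noteq> b'" using cone F b' by blast
  then have "b' \<in> \<sigma> - {b}" using F by blast
  then show "\<sigma> - {b} \<notin> \<Delta>" using b' by blast
qed (use assms(1,2) \<Delta>' in auto)

text \<open>The complex \<open>K\<close> is the join of \<open>L\<close> with the full edge on
  \<open>p\<close> and \<open>x\<close>, together with the cone over \<open>L\<close> with apex
  \<open>q\<close>. It contains both suspensions and collapses onto each by toggling the vertex that
  is kept.\<close>

lemma equivclp_susp_change_vertex:
  assumes "simplicial_complex L" "p \<noteq> q" "x \<noteq> q"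
    and fresh: "p \<notin> \<Union> L" "q \<notin> \<Union> L" "x \<notin> \<Union> L"
  shows "equivclp elementary_collapse (susp p q L) (susp x q L)"
proof (cases "p = x")
  case False
  define C where "C = L \<union> insert p ` L"
  define K where "K = (C \<union> insert x ` C) \<union> susp p q L"
  have K: "simplicial_complex K"
    unfolding K_def C_def
    by (intro simplicial_complex_Un simplicial_complex_insert_image simplicial_complex_susp assms(1))
  have K_iff: "G \<in> K \<longleftrightarrow> (\<exists>F\<in>L. G \<in> {F, insert p F, insert q F, insert x F, insert x (insert p F)})" for G
    by (auto simp: K_def C_def mem_susp_iff)
  \<comment> \<open>Here \<open>u\<close> is the vertex kept and \<open>v\<close> the one collapsed
    away, so that one argument covers both directions.\<close>
  have "collapses_onto K (susp u q L)"
    if uv: "u = p \<and> v = x \<or> u = x \<and> v = p" for u v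
  proof (rule collapses_onto_by_toggling[where b = u])
    show "susp u q L \<subseteq> K" using uv by (auto simp: mem_susp_iff K_iff)
    fix \<sigma> assume "\<sigma> \<in> K" "\<sigma> \<notin> susp u q L"
    then obtain F where F: "F \<in> L" "\<sigma> = insert v F \<or> \<sigma> = insert u (insert v F)"
      using uv by (auto simp: mem_susp_iff K_iff insert_commute)
    then have "insert u \<sigma> = insert u (insert v F)" by blast
    then show "insert u \<sigma> \<in> K" using F uv by (auto simp: K_iff insert_commute)
    have v: "v \<in> \<sigma> - {u}" using uv F \<open>p \<noteq> x\<close> by blast
    \<comment> \<open>Containing \<open>v\<close> certifies that a face is outside the suspension,
      and toggling \<open>u\<close> does not affect this.\<close>
    have "v \<notin> \<Union> (susp u q L)"
      using uv \<open>p \<noteq> x\<close> assms by (auto simp: mem_susp_iff)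
    then show "\<sigma> - {u} \<notin> susp u q L" using v by blast
  qed (use K simplicial_complex_susp[OF assms(1)] in auto)
  then have "elementary_collapse\<^sup>*\<^sup>* K (susp p q L)" "elementary_collapse\<^sup>*\<^sup>* K (susp x q L)"
    unfolding collapses_onto_def by auto
  then show ?thesis
    by (meson equivclp_sym equivclp_trans rtranclp_into_equivclp)
qed simp

text \<open>The vertices are exchanged one at a time, \<open>p\<close> for \<open>x\<close> and then
  \<open>q\<close> for \<open>y\<close>. If \<open>x = q\<close>, the intermediate suspension would
  be degenerate; then \<open>q\<close> stays and \<open>p\<close> is exchanged for
  \<open>y\<close>.\<close>

lemma equivclp_susp_change_vertices:
  assumes L: "simplicial_complex L" and "p \<noteq> q" "x \<noteq> y"
    and "p \<notin> \<Union> L" "q \<notin> \<Union> L" "x \<notin> \<Union> L" "y \<notin> \<Union> L"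
  shows "equivclp elementary_collapse (susp p q L) (susp x y L)"
proof (cases "x = q")
  case True
  then show ?thesis
    using equivclp_susp_change_vertex[OF L, of p q y] assms by (simp add: susp_commute[of q])
next
  case False
  have "equivclp elementary_collapse (susp p q L) (susp x q L)"
    using equivclp_susp_change_vertex[OF L] False assms by blast
  moreover have "equivclp elementary_collapse (susp q x L) (susp y x L)"
    using equivclp_susp_change_vertex[OF L, of q x y] False assms by blast
  ultimately show ?thesis
    by (metis equivclp_trans susp_commute)
qed

section \<open>Monomial ideals\<close>

text \<open>Monomials are exponent vectors written additively, so divisibility is the pointwise
  order.\<close>

definition mono_dvd :: "'v mono \<Rightarrow> 'v mono \<Rightarrow> bool" where
  "mono_dvd g m \<longleftrightarrow> (\<forall>x. Poly_Mapping.lookup g x \<le> Poly_Mapping.lookup m x)"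

definition multiples :: "'v mono set \<Rightarrow> 'v mono set" where
  "multiples G = {m. \<exists>g\<in>G. mono_dvd g m}"

text \<open>A concrete model of the ideal generated by the monomials in \<open>G\<close>, which
  turns membership into divisibility of the single monomials of a polynomial.\<close>

definition supported_ideal :: "'v set \<Rightarrow> 'v mono set \<Rightarrow> 'v zpoly set" where
  "supported_ideal X G = {p. Poly_Mapping.keys p \<subseteq> monomials X \<inter> multiples G}"

lemma mono_dvd_obtain:
  assumes "mono_dvd g m"
  obtains h where "m = h + g" "Poly_Mapping.keys h \<subseteq> Poly_Mapping.keys m"
proof
  show "m = (m - g) + g"
    using assms by (intro poly_mapping_eqI) (simp add: mono_dvd_def lookup_add lookup_minus)
  show "Poly_Mapping.keys (m - g) \<subseteq> Poly_Mapping.keys m"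
    by (auto simp: in_keys_iff lookup_minus)
qed

lemma multiples_add: "m \<in> multiples G \<Longrightarrow> h + m \<in> multiples G"
  unfolding multiples_def mono_dvd_def by (auto simp: lookup_add intro!: trans_le_add2)

lemma mem_multiples_Un [simp]: "m \<in> multiples (G \<union> H) \<longleftrightarrow> m \<in> multiples G \<or> m \<in> multiples H"
  unfolding multiples_def by blast

lemma monomials_add: "m \<in> monomials X \<Longrightarrow> h \<in> monomials X \<Longrightarrow> h + m \<in> monomials X"
  using Poly_Mapping.keys_add[of h m] unfolding monomials_def by blast

lemma carrier_zpoly_ring: "carrier (zpoly_ring X) = {p. Poly_Mapping.keys p \<subseteq> monomials X}"
  by (simp add: zpoly_ring_def)

lemma mpoly_mem_supported_ideal [simp]:
  "mpoly m \<in> supported_ideal X G \<longleftrightarrow> m \<in> monomials X \<and> m \<in> multiples G"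
  by (simp add: supported_ideal_def mpoly_def)

lemma mpoly_mult: "mpoly m * mpoly n = mpoly (m + n)"
  by (simp add: mpoly_def mult_single)

lemma ring_zpoly_ring: "ring (zpoly_ring X)"
  using cring_zpoly_ring cring_def by blast

text \<open>The monomials of a product are sums of exponent vectors of its factors, and adding any
  vector to a multiple of a generator gives a multiple again.\<close>

lemma ideal_supported_ideal: "ideal (supported_ideal X G) (zpoly_ring X)"
proof -
  have mult: "p * q \<in> supported_ideal X G" if "Poly_Mapping.keys p \<subseteq> monomials X" "q \<in> supported_ideal X G" for p q
    using that keys_mult[of p q] monomials_add multiples_add
    unfolding supported_ideal_def by blast
  show ?thesis
  proof (rule idealI[OF ring_zpoly_ring])
    show "subgroup (supported_ideal X G) (add_monoid (zpoly_ring X))"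
    proof (rule group.subgroupI)
      show "Group.group (add_monoid (zpoly_ring X))"
        using ring_zpoly_ring ring.is_abelian_group abelian_group.a_group by blast
      show "supported_ideal X G \<noteq> {}"
        by (auto simp: supported_ideal_def intro: exI[of _ 0])
      fix p assume p: "p \<in> supported_ideal X G"
      \<comment> \<open>The inverse in the ring record is given abstractly; uniqueness of additive
        inverses identifies it with ordinary negation.\<close>
      have "- p \<oplus>\<^bsub>zpoly_ring X\<^esub> p = \<zero>\<^bsub>zpoly_ring X\<^esub>" by (simp add: zpoly_ring_def)
      moreover have "p \<in> carrier (zpoly_ring X)" "- p \<in> carrier (zpoly_ring X)"
        using p by (auto simp: supported_ideal_def carrier_zpoly_ring)
      ultimately have "\<ominus>\<^bsub>zpoly_ring X\<^esub> p = - p"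
        using ring_zpoly_ring abelian_group.minus_equality ring_def by metis
      then show "inv\<^bsub>add_monoid (zpoly_ring X)\<^esub> p \<in> supported_ideal X G"
        using p by (simp add: a_inv_def supported_ideal_def)
    next
      fix p q assume "p \<in> supported_ideal X G" "q \<in> supported_ideal X G"
      then show "p \<otimes>\<^bsub>add_monoid (zpoly_ring X)\<^esub> q \<in> supported_ideal X G"
        using Poly_Mapping.keys_add[of p q] by (auto simp: supported_ideal_def zpoly_ring_def)
    qed (auto simp: supported_ideal_def zpoly_ring_def)
  next
    fix p q assume "p \<in> supported_ideal X G" "q \<in> carrier (zpoly_ring X)"
    then have "q * p \<in> supported_ideal X G" using mult by (simp add: carrier_zpoly_ring)
    then show "q \<otimes>\<^bsub>zpoly_ring X\<^esub> p \<in> supported_ideal X G" "p \<otimes>\<^bsub>zpoly_ring X\<^esub> q \<in> supported_ideal X G"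
      by (simp_all add: zpoly_ring_def mult.commute)
  qed
qed

text \<open>A polynomial is the sum of its terms, and each term here is a generator multiplied by a
  term over \<open>X\<close>.\<close>

lemma supported_ideal_subset_ideal:
  assumes J: "ideal J (zpoly_ring X)" and G: "mpoly ` G \<subseteq> J"
  shows "supported_ideal X G \<subseteq> J"
proof
  fix p :: "'a zpoly" assume p: "p \<in> supported_ideal X G"
  interpret ideal J "zpoly_ring X" by (fact J)
  have add: "u + v \<in> J" if "u \<in> J" "v \<in> J" for u v
    using additive_subgroup.a_closed[OF is_additive_subgroup that] by (simp add: zpoly_ring_def)
  have term_mem: "Poly_Mapping.single m c \<in> J" if m: "m \<in> monomials X \<inter> multiples G" for m c
  proof -
    obtain g where g: "g \<in> G" "mono_dvd g m" using m by (auto simp: multiples_def)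
    obtain h where h: "m = h + g" "Poly_Mapping.keys h \<subseteq> Poly_Mapping.keys m" using mono_dvd_obtain[OF g(2)] .
    have "Poly_Mapping.single h c \<in> carrier (zpoly_ring X)"
      using h m by (auto simp: carrier_zpoly_ring monomials_def)
    then have "Poly_Mapping.single h c * mpoly g \<in> J"
      using I_l_closed[of "mpoly g" "Poly_Mapping.single h c"] G g by (auto simp: zpoly_ring_def)
    then show ?thesis by (simp add: h mpoly_def mult_single)
  qed
  have zero: "0 \<in> J" using additive_subgroup.zero_closed[OF is_additive_subgroup] by (simp add: zpoly_ring_def)
  have "(\<Sum>m\<in>A. Poly_Mapping.single m (Poly_Mapping.lookup p m)) \<in> J" if "A \<subseteq> Poly_Mapping.keys p" "finite A" for A
    using that(2,1)
  proof (induction A rule: finite_induct)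
    case (insert m A)
    then have "Poly_Mapping.single m (Poly_Mapping.lookup p m) \<in> J"
      using term_mem p unfolding supported_ideal_def by blast
    then show ?case using insert add by simp
  qed (use zero in simp)
  moreover have "p = (\<Sum>m\<in>Poly_Mapping.keys p. Poly_Mapping.single m (Poly_Mapping.lookup p m))"
    by (rule poly_mapping_eqI) (auto simp: lookup_sum lookup_single when_def in_keys_iff)
  ultimately show "p \<in> J" by (metis finite_keys order_refl)
qed

section \<open>Generated and enlarged monomial ideals described by supports\<close>

lemma mem_multiples_self: "g \<in> G \<Longrightarrow> g \<in> multiples G"
  by (auto simp: multiples_def mono_dvd_def)

text \<open>Trapping \<open>S\<close> between the generators and the candidate ideal allows
  \<open>S\<close> to contain a whole ideal, as it does when generators are adjoined.\<close>

lemma genideal_eq_supported_ideal: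
  assumes "mpoly ` G \<subseteq> S" "S \<subseteq> supported_ideal X G"
  shows "genideal (zpoly_ring X) S = supported_ideal X G"
proof -
  interpret ring "zpoly_ring X" by (fact ring_zpoly_ring)
  have "S \<subseteq> carrier (zpoly_ring X)"
    using assms(2) by (auto simp: supported_ideal_def carrier_zpoly_ring)
  then have "ideal (genideal (zpoly_ring X) S) (zpoly_ring X)" "S \<subseteq> genideal (zpoly_ring X) S"
    using genideal_ideal genideal_self by auto
  then have "supported_ideal X G \<subseteq> genideal (zpoly_ring X) S"
    using supported_ideal_subset_ideal assms(1) by blast
  moreover have "genideal (zpoly_ring X) S \<subseteq> supported_ideal X G"
    using genideal_minimal[OF ideal_supported_ideal assms(2)] .
  ultimately show ?thesis by blast
qed

lemma genideal_monomials:
  assumes "G \<subseteq> monomials X"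
  shows "genideal (zpoly_ring X) (mpoly ` G) = supported_ideal X G"
  using assms mem_multiples_self[of _ G] by (intro genideal_eq_supported_ideal) auto

text \<open>Two variable sets occur because the old ideal may live in a smaller polynomial ring:
  \<open>Y = X\<close> serves for adjoining a variable of the ring, and a larger \<open>X\<close>
  for introducing \<open>b'\<close>.\<close>

lemma ideal_adjoin_supported_ideal:
  assumes "Y \<subseteq> X" "G \<subseteq> monomials Y" "T \<subseteq> monomials X"
  shows "ideal_adjoin X (supported_ideal Y G) (mpoly ` T) = supported_ideal X (G \<union> T)"
  unfolding ideal_adjoin_def
proof (rule genideal_eq_supported_ideal)
  show "mpoly ` (G \<union> T) \<subseteq> supported_ideal Y G \<union> mpoly ` T"
    using assms(2) mem_multiples_self by auto
  have "monomials Y \<subseteq> monomials X" using assms(1) by (auto simp: monomials_def)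
  then show "supported_ideal Y G \<union> mpoly ` T \<subseteq> supported_ideal X (G \<union> T)"
    using assms mem_multiples_self[of _ T] by (auto simp: supported_ideal_def mpoly_def)
qed

section \<open>Faces\<close>

text \<open>The product of the variables in \<open>F\<close>, in additive notation; it leads from a
  face back to its monomial.\<close>

definition sqfree :: "'v set \<Rightarrow> 'v mono" where
  "sqfree F = (\<Sum>x\<in>F. Poly_Mapping.single x 1)"

lemma lookup_sqfree:
  assumes "finite F"
  shows "Poly_Mapping.lookup (sqfree F) x = (if x \<in> F then 1 else 0)"
  using assms unfolding sqfree_def
  by (induction F rule: finite_induct) (auto simp: lookup_add lookup_single when_def)

lemma keys_sqfree: "finite F \<Longrightarrow> Poly_Mapping.keys (sqfree F) = F"
  by (auto simp: in_keys_iff lookup_sqfree split: if_splits)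

lemma sqfree_insert: "finite F \<Longrightarrow> a \<notin> F \<Longrightarrow> sqfree (insert a F) = Poly_Mapping.single a 1 + sqfree F"
  by (simp add: sqfree_def)

lemma multiples_trans: "m \<in> multiples G \<Longrightarrow> mono_dvd m n \<Longrightarrow> n \<in> multiples G"
  unfolding multiples_def mono_dvd_def by (auto intro: order_trans)

lemma single_mono_dvd_iff:
  "mono_dvd (Poly_Mapping.single x k) m \<longleftrightarrow> k \<le> Poly_Mapping.lookup m x"
  by (auto simp: mono_dvd_def lookup_single when_def)

text \<open>An exponent of at least 2 would make \<open>m\<close> a multiple of the square of a
  variable.\<close>

lemma eq_sqfree_keys:
  assumes "\<And>x. x \<in> X \<Longrightarrow> Poly_Mapping.single x 2 \<in> multiples G"
    and "m \<in> monomials X" "m \<notin> multiples G"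
  shows "m = sqfree (Poly_Mapping.keys m)"
proof (rule poly_mapping_eqI)
  fix x
  have "Poly_Mapping.lookup m x \<le> 1"
  proof (cases "x \<in> X")
    case True
    then have "\<not> 2 \<le> Poly_Mapping.lookup m x"
      using assms(3) multiples_trans[OF assms(1)] unfolding single_mono_dvd_iff by blast
    then show ?thesis by simp
  next
    case False
    then have "x \<notin> Poly_Mapping.keys m" using assms(2) by (auto simp: monomials_def)
    then show ?thesis by (simp add: in_keys_iff)
  qed
  then show "Poly_Mapping.lookup m x = Poly_Mapping.lookup (sqfree (Poly_Mapping.keys m)) x"
    by (simp add: lookup_sqfree in_keys_iff)
qed

lemma R_supported_ideal:
  assumes "finite X" "\<And>x. x \<in> X \<Longrightarrow> Poly_Mapping.single x 2 \<in> multiples G"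
  shows "R X (supported_ideal X G) = {F. F \<subseteq> X \<and> sqfree F \<notin> multiples G}"
proof (intro equalityI subsetI)
  fix F assume "F \<in> R X (supported_ideal X G)"
  then obtain m where "m \<in> monomials X" "m \<notin> multiples G" "F = Poly_Mapping.keys m"
    by (auto simp: R_def)
  then show "F \<in> {F. F \<subseteq> X \<and> sqfree F \<notin> multiples G}"
    using eq_sqfree_keys[OF assms(2)] by (auto simp: monomials_def)
next
  fix F assume F: "F \<in> {F. F \<subseteq> X \<and> sqfree F \<notin> multiples G}"
  then have "F = Poly_Mapping.keys (sqfree F)"
    using assms(1) finite_subset by (metis keys_sqfree mem_Collect_eq)
  then show "F \<in> R X (supported_ideal X G)"
    using F by (auto simp: R_def monomials_def)
qed

text \<open>A divisor of a monomial outside the ideal is itself outside the ideal.\<close>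

lemma simplicial_complex_R:
  assumes "finite X" "\<And>x. x \<in> X \<Longrightarrow> Poly_Mapping.single x 2 \<in> multiples G"
  shows "simplicial_complex (R X (supported_ideal X G))"
proof -
  have R: "R X (supported_ideal X G) = {F. F \<subseteq> X \<and> sqfree F \<notin> multiples G}"
    using assms by (rule R_supported_ideal)
  have fin: "finite F" if "F \<subseteq> X" for F
    using that assms(1) by (rule finite_subset)
  have "\<tau> \<in> R X (supported_ideal X G)" if s: "\<sigma> \<in> R X (supported_ideal X G)" "\<tau> \<subseteq> \<sigma>" for \<sigma> \<tau>
  proof -
    have "\<sigma> \<subseteq> X" "\<tau> \<subseteq> X" using s by (auto simp: R)
    then have "mono_dvd (sqfree \<tau>) (sqfree \<sigma>)"
      using s(2) fin by (auto simp: mono_dvd_def lookup_sqfree)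
    then show ?thesis
      using s(1) \<open>\<tau> \<subseteq> X\<close> multiples_trans[of "sqfree \<tau>" G "sqfree \<sigma>"] by (auto simp: R)
  qed
  moreover have "finite (R X (supported_ideal X G))"
    using assms(1) by (simp add: R)
  moreover have "finite F" if "F \<in> R X (supported_ideal X G)" for F
    using that fin[of F] by (simp add: R)
  ultimately show ?thesis
    unfolding simplicial_complex_def by (intro conjI ballI allI impI)
qed

section \<open>Colon ideals, domination and the added variable in terms of faces\<close>

lemma mpoly_mem_ideal_colon:
  assumes "a \<in> X"
  shows "mpoly m \<in> ideal_colon X (supported_ideal X G) a \<longleftrightarrow>
    m \<in> monomials X \<and> Poly_Mapping.single a 1 + m \<in> multiples G"
proof -
  have "Poly_Mapping.single a 1 \<in> monomials X" using assms by (simp add: monomials_def)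
  then have "m \<in> monomials X \<Longrightarrow> Poly_Mapping.single a 1 + m \<in> monomials X"
    using monomials_add by blast
  then show ?thesis
    unfolding ideal_colon_def var_def
    by (auto simp: mpoly_mult carrier_zpoly_ring simp del: mpoly_mem_supported_ideal)
      (auto simp: mpoly_def supported_ideal_def)
qed

text \<open>If \<open>m\<close> is outside the colon ideal, then \<open>a\<close> times
  \<open>m\<close> is outside the ideal and hence square-free. So \<open>a\<close> does not divide
  \<open>m\<close>, which is why the colon complex avoids \<open>a\<close>.\<close>

lemma R_ideal_colon:
  assumes "finite X" "\<And>x. x \<in> X \<Longrightarrow> Poly_Mapping.single x 2 \<in> multiples G" "a \<in> X"
  shows "R X (ideal_colon X (supported_ideal X G) a) = link a (R X (supported_ideal X G))"
proof (intro equalityI subsetI)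
  fix F assume "F \<in> R X (ideal_colon X (supported_ideal X G) a)"
  then obtain m where m: "m \<in> monomials X" "Poly_Mapping.single a 1 + m \<notin> multiples G"
      "F = Poly_Mapping.keys m"
    using mpoly_mem_ideal_colon[OF assms(3)] by (auto simp: R_def)
  define n where "n = Poly_Mapping.single a 1 + m"
  have "Poly_Mapping.keys n = insert a F"
    using m(3) by (auto simp: n_def in_keys_iff lookup_add lookup_single when_def split: if_splits)
  moreover have n: "n \<in> monomials X"
    using m(1) assms(3) \<open>Poly_Mapping.keys n = insert a F\<close> m(3) by (auto simp: monomials_def)
  moreover have eq: "n = sqfree (Poly_Mapping.keys n)"
    using eq_sqfree_keys[OF assms(2) n] m(2) by (simp add: n_def)
  moreover have "Poly_Mapping.lookup n a \<le> 1"
    by (subst eq) (simp add: lookup_sqfree)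
  then have "a \<notin> F"
    using m(3) by (auto simp: n_def lookup_add in_keys_iff)
  ultimately show "F \<in> link a (R X (supported_ideal X G))"
    using m by (auto simp: link_def R_supported_ideal[OF assms(1,2)] n_def monomials_def)
next
  fix F assume "F \<in> link a (R X (supported_ideal X G))"
  then have F: "a \<notin> F" "F \<subseteq> X" "sqfree (insert a F) \<notin> multiples G"
    by (auto simp: link_def R_supported_ideal[OF assms(1,2)])
  then have "finite F" using assms(1) finite_subset by blast
  then have "sqfree F \<in> monomials X" "F = Poly_Mapping.keys (sqfree F)"
      "mpoly (sqfree F) \<notin> ideal_colon X (supported_ideal X G) a"
    using F by (auto simp: monomials_def keys_sqfree sqfree_insert mpoly_mem_ideal_colon[OF assms(3)])
  then show "F \<in> R X (ideal_colon X (supported_ideal X G) a)" unfolding R_def by blast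
qed

lemma var_power2: "var x ^ 2 = mpoly (Poly_Mapping.single x 2)"
  by (simp add: var_def power2_eq_square mpoly_mult numeral_2_eq_2 flip: single_add)

lemma squares_adjoin:
  assumes "\<And>x. x \<in> X \<Longrightarrow> Poly_Mapping.single x 2 \<in> multiples G"
    and "Poly_Mapping.single b' 2 \<in> T" and "x \<in> insert b' X"
  shows "Poly_Mapping.single x 2 \<in> multiples (G \<union> T)"
  using assms mem_multiples_self[OF assms(2)] by auto

text \<open>Suppose that a face monomial is divisible by neither \<open>a\<close> nor
  \<open>b\<close>. Then it is outside the ideal enlarged by both. The cone condition equates that
  ideal with the colon by \<open>b\<close> of the ideal enlarged by \<open>a\<close>, so multiplying
  by \<open>b\<close> leads neither into the ideal nor to a multiple of \<open>a\<close>.\<close>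

lemma dominates_insert_face:
  assumes "finite X" "G \<subseteq> monomials X"
    and sq: "\<And>x. x \<in> X \<Longrightarrow> Poly_Mapping.single x 2 \<in> multiples G"
    and "a \<in> X" "b \<in> X" and dom: "dominates X (supported_ideal X G) a b"
    and F: "F \<in> R X (supported_ideal X G)" "a \<notin> F"
  shows "insert b F \<in> R X (supported_ideal X G) \<and> a \<notin> insert b F"
proof (cases "b \<in> F")
  case True
  then show ?thesis using F by (auto simp: insert_absorb)
next
  case False
  let ?e = "\<lambda>x::'a. Poly_Mapping.single x (1::nat)"
  have e: "?e a \<in> monomials X" "?e b \<in> monomials X" using assms(4,5) by (auto simp: monomials_def)
  have adj: "ideal_adjoin X (supported_ideal X H) {var x} = supported_ideal X (H \<union> {?e x})"
    if "H \<subseteq> monomials X" "?e x \<in> monomials X" for H x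
    using ideal_adjoin_supported_ideal[of X X H "{?e x}"] that by (simp add: var_def)
  have cone: "ideal_colon X (supported_ideal X (G \<union> {?e a})) b = supported_ideal X (G \<union> {?e a} \<union> {?e b})"
    using dom adj[of G a] adj[of "G \<union> {?e a}" b] e assms(2)
    unfolding dominates_def is_cone_def by simp
  have F': "F \<subseteq> X" "sqfree F \<notin> multiples G" "finite F"
    using F(1) assms(1) finite_subset by (auto simp: R_supported_ideal[OF assms(1) sq])
  have single: "sqfree H \<in> multiples {?e x} \<longleftrightarrow> x \<in> H" if "finite H" for H x
    using that by (simp add: multiples_def single_mono_dvd_iff lookup_sqfree)
  have "mpoly (sqfree F) \<notin> supported_ideal X (G \<union> {?e a} \<union> {?e b})"
    using F' F(2) False single by (simp only: mpoly_mem_supported_ideal mem_multiples_Un) simp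
  moreover have "sqfree F \<in> monomials X" using F' by (simp add: monomials_def keys_sqfree)
  ultimately have "?e b + sqfree F \<notin> multiples (G \<union> {?e a})"
    unfolding cone[symmetric] mpoly_mem_ideal_colon[OF assms(5)] by blast
  then have "sqfree (insert b F) \<notin> multiples (G \<union> {?e a})"
    using sqfree_insert[OF F'(3) False] by simp
  then have "sqfree (insert b F) \<notin> multiples G" "a \<notin> insert b F"
    using single[of "insert b F" a] F'(3) by (simp_all only: mem_multiples_Un) auto
  then show ?thesis
    using F' assms(5) by (auto simp: R_supported_ideal[OF assms(1) sq])
qed

text \<open>No square-free monomial is divisible by \<open>b'^2\<close>, so on faces the new
  generators only forbid \<open>a\<close> and \<open>b'\<close> from occurring together.\<close>

lemma R_adjoin_cone_over_deletion:
  assumes "finite X" "G \<subseteq> monomials X"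
    and sq: "\<And>x. x \<in> X \<Longrightarrow> Poly_Mapping.single x 2 \<in> multiples G"
    and "a \<in> X" "b' \<notin> X"
    and T: "T = {Poly_Mapping.single a 1 + Poly_Mapping.single b' 1, Poly_Mapping.single b' 2}"
  shows "R (insert b' X) (supported_ideal (insert b' X) (G \<union> T)) =
    R X (supported_ideal X G) \<union> insert b' ` {F \<in> R X (supported_ideal X G). a \<notin> F}"
proof -
  let ?\<Delta> = "R X (supported_ideal X G)"
  have sq': "Poly_Mapping.single x 2 \<in> multiples (G \<union> T)" if "x \<in> insert b' X" for x
    using squares_adjoin[of X G b' T, OF sq _ that] T by simp
  have "a \<noteq> b'" using assms by blast
  have T_iff: "sqfree F \<in> multiples T \<longleftrightarrow> a \<in> F \<and> b' \<in> F" if "finite F" for F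
  proof -
    have "mono_dvd (Poly_Mapping.single a 1 + Poly_Mapping.single b' 1) (sqfree F) \<longleftrightarrow> a \<in> F \<and> b' \<in> F"
      using that \<open>a \<noteq> b'\<close>
      by (auto simp: mono_dvd_def lookup_sqfree lookup_add lookup_single when_def split: if_splits)
    moreover have "\<not> mono_dvd (Poly_Mapping.single b' 2) (sqfree F)"
      using that by (simp add: single_mono_dvd_iff lookup_sqfree)
    ultimately show ?thesis by (simp add: multiples_def T)
  qed
  \<comment> \<open>The generators in \<open>G\<close> do not involve \<open>b'\<close>, so their
    divisibility tests ignore it.\<close>
  have G_iff: "sqfree (F - {b'}) \<in> multiples G \<longleftrightarrow> sqfree F \<in> multiples G" if "finite F" for F
  proof -
    have "mono_dvd g (sqfree (F - {b'})) \<longleftrightarrow> mono_dvd g (sqfree F)" if "g \<in> G" for g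
    proof -
      have "Poly_Mapping.lookup g b' = 0"
        using that assms(2,5) by (auto simp: monomials_def simp flip: not_in_keys_iff_lookup_eq_zero)
      then show ?thesis
        unfolding mono_dvd_def using \<open>finite F\<close>
        by (metis Diff_iff finite_Diff lookup_sqfree singletonD zero_le)
    qed
    then show ?thesis by (auto simp: multiples_def)
  qed
  have fin': "finite (insert b' X)" using assms(1) by simp
  have R: "?\<Delta> = {F. F \<subseteq> X \<and> sqfree F \<notin> multiples G}"
    using assms(1) sq by (rule R_supported_ideal)
  have R': "R (insert b' X) (supported_ideal (insert b' X) (G \<union> T)) =
      {F. F \<subseteq> insert b' X \<and> sqfree F \<notin> multiples (G \<union> T)}"
    using fin' sq' by (rule R_supported_ideal)
  have iff: "F \<in> R (insert b' X) (supported_ideal (insert b' X) (G \<union> T)) \<longleftrightarrow>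
      F - {b'} \<in> ?\<Delta> \<and> \<not> (a \<in> F \<and> b' \<in> F)" for F
  proof (cases "F \<subseteq> insert b' X")
    case True
    then have "finite F" using fin' finite_subset by blast
    then show ?thesis
      using True T_iff[of F] G_iff[of F]
      unfolding R R' by auto
  next
    case False
    then show ?thesis
      unfolding R R' by auto
  qed
  have sub: "F \<subseteq> X" if "F \<in> ?\<Delta>" for F
    using that by (simp add: R)
  show ?thesis
  proof (intro equalityI subsetI)
    fix F assume F: "F \<in> R (insert b' X) (supported_ideal (insert b' X) (G \<union> T))"
    show "F \<in> ?\<Delta> \<union> insert b' ` {F \<in> ?\<Delta>. a \<notin> F}"
    proof (cases "b' \<in> F")
      case True
      then have "F = insert b' (F - {b'})" by blast
      then show ?thesis using F True unfolding iff by blast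
    next
      case False
      then show ?thesis using F unfolding iff by simp
    qed
  next
    fix F assume "F \<in> ?\<Delta> \<union> insert b' ` {F \<in> ?\<Delta>. a \<notin> F}"
    then consider "F \<in> ?\<Delta>" | H where "H \<in> ?\<Delta>" "a \<notin> H" "F = insert b' H" by blast
    then show "F \<in> R (insert b' X) (supported_ideal (insert b' X) (G \<union> T))"
    proof cases
      case 1
      then have "b' \<notin> F" using sub assms(5) by blast
      then show ?thesis using 1 by (simp add: iff)
    next
      case 2
      then have "F - {b'} = H" using sub assms(5) by blast
      then show ?thesis using 2 \<open>a \<noteq> b'\<close> by (auto simp: iff)
    qed
  qed
qed

section \<open>The three collapses and the passage to a genuine suspension\<close>

theorem theorem3p5:
  fixes X :: "'v set" and I I' :: "'v zpoly set" and a b b' :: 'v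
  assumes "finite X"
    and "monomial_ideal X I"
    and "\<forall>x\<in>X. var x ^ 2 \<in> I"
    and "a \<in> X" and "b \<in> X"
    and "dominates X I a b"
    and "b' \<notin> X"
    and "I' = ideal_adjoin (insert b' X) I {var a * var b', var b' ^ 2}"
  shows "collapses_onto (R (insert b' X) I') (R X I) \<and>
    collapses_onto (R X I) (susp a b (R X (ideal_colon X I a))) \<and>
    collapses_onto (R (insert b' X) I')
      (susp a b' (R (insert b' X) (ideal_colon (insert b' X) I' a))) \<and>
    (\<forall>x y. x \<noteq> y \<and> x \<notin> \<Union> (R X (ideal_colon X I a)) \<and> y \<notin> \<Union> (R X (ideal_colon X I a)) \<longrightarrow>
      simple_homotopic (R X I) (susp x y (R X (ideal_colon X I a))))"
proof -
  obtain G where G: "G \<subseteq> monomials X" and I: "I = supported_ideal X G"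
    using assms(2) genideal_monomials unfolding monomial_ideal_def by metis
  define T where "T = {Poly_Mapping.single a 1 + Poly_Mapping.single b' 1, Poly_Mapping.single b' (2::nat)}"
  have "T \<subseteq> monomials (insert b' X)"
    using assms(4) by (auto simp: T_def monomials_def in_keys_iff lookup_add lookup_single when_def split: if_splits)
  moreover have "mpoly ` T = {var a * var b', var b' ^ 2}"
    by (simp add: T_def var_power2) (simp add: var_def mpoly_mult)
  ultimately have I': "I' = supported_ideal (insert b' X) (G \<union> T)"
    using ideal_adjoin_supported_ideal[of X "insert b' X" G T] G assms(8) I by auto
  have sq: "Poly_Mapping.single x 2 \<in> multiples G" if "x \<in> X" for x
    using assms(3) that by (auto simp: I var_power2)
  have sq': "Poly_Mapping.single x 2 \<in> multiples (G \<union> T)" if "x \<in> insert b' X" for x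
    using squares_adjoin[of X G b' T, OF sq _ that] T_def by simp
  define \<Delta> \<Delta>' where "\<Delta> = R X I" and "\<Delta>' = R (insert b' X) I'"
  define L where "L = link a \<Delta>"
  have fin': "finite (insert b' X)" using assms(1) by simp
  have \<Delta>: "simplicial_complex \<Delta>" "simplicial_complex \<Delta>'"
    unfolding \<Delta>_def \<Delta>'_def I I'
    using simplicial_complex_R[OF assms(1) sq] simplicial_complex_R[OF fin' sq'] by auto
  have colon: "R X (ideal_colon X I a) = L" "R (insert b' X) (ideal_colon (insert b' X) I' a) = link a \<Delta>'"
    unfolding L_def \<Delta>_def \<Delta>'_def I I'
    using R_ideal_colon[OF assms(1) sq assms(4)] R_ideal_colon[OF fin' sq'] assms(4) by auto
  have vert: "b' \<notin> \<Union> \<Delta>"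
    using assms(7) by (auto simp: \<Delta>_def R_def monomials_def)
  have \<Delta>'_eq: "\<Delta>' = \<Delta> \<union> insert b' ` {F \<in> \<Delta>. a \<notin> F}"
    unfolding \<Delta>_def \<Delta>'_def I I'
    using R_adjoin_cone_over_deletion[OF assms(1) G sq assms(4,7) T_def] by simp
  have cone: "insert b F \<in> \<Delta> \<and> a \<notin> insert b F" if "F \<in> \<Delta>" "a \<notin> F" for F
    using dominates_insert_face[OF assms(1) G sq assms(4,5)] assms(6) that unfolding \<Delta>_def I by blast
  have "a \<noteq> b'" using assms(4,7) by blast
  \<comment> \<open>In \<Delta>' the faces avoiding \<open>a\<close> form a cone with apex
    \<open>b'\<close> by construction: old ones acquire \<open>b'\<close> and new ones already
    contain it.\<close>
  then have cone': "insert b' F \<in> \<Delta>' \<and> a \<notin> insert b' F" if "F \<in> \<Delta>'" "a \<notin> F" for F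
    using that unfolding \<Delta>'_eq by auto
  \<comment> \<open>All faces added in \<Delta>' avoid \<open>a\<close>, so the link of
    \<open>a\<close> is unchanged.\<close>
  have link': "link a \<Delta>' = L"
    using \<open>a \<noteq> b'\<close> by (auto simp: L_def link_def \<Delta>'_eq)
  have 1: "collapses_onto \<Delta>' \<Delta>"
    using collapses_onto_cone_over_deletion[OF \<Delta> \<Delta>'_eq vert] cone by blast
  have 2: "collapses_onto \<Delta> (susp a b L)"
    using collapses_onto_susp_link[OF \<Delta>(1)] cone unfolding L_def by blast
  have 3: "collapses_onto \<Delta>' (susp a b' L)"
    using collapses_onto_susp_link[OF \<Delta>(2) cone'] link' by simp
  have L: "simplicial_complex L" unfolding L_def by (rule simplicial_complex_link[OF \<Delta>(1)])
  \<comment> \<open>\<open>b\<close> may be a vertex of \<open>L\<close>, but \<open>a\<close> and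
    \<open>b'\<close> are not, so the suspension in \<open>3\<close> is a genuine one.\<close>
  have fresh: "a \<notin> \<Union> L" "b' \<notin> \<Union> L" using vert by (auto simp: L_def link_def)
  have "simple_homotopic \<Delta> (susp x y L)" if "x \<noteq> y" "x \<notin> \<Union> L" "y \<notin> \<Union> L" for x y
  proof -
    \<comment> \<open>The collapses of \<Delta>' onto \<Delta> and onto the suspension by
      \<open>a\<close> and \<open>b'\<close> form a zigzag; it then remains to exchange
      \<open>a\<close> and \<open>b'\<close> for \<open>x\<close> and \<open>y\<close>.\<close>
    have "equivclp elementary_collapse \<Delta> \<Delta>'" "equivclp elementary_collapse \<Delta>' (susp a b' L)"
      using 1 3 unfolding collapses_onto_def by (meson equivclp_sym rtranclp_into_equivclp)+
    then have "equivclp elementary_collapse \<Delta> (susp x y L)"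
      using equivclp_susp_change_vertices[OF L \<open>a \<noteq> b'\<close> that(1) fresh that(2,3)]
      by (meson equivclp_trans)
    then show ?thesis
      using \<Delta>(1) simplicial_complex_susp[OF L] unfolding simple_homotopic_def by blast
  qed
  then show ?thesis
    using 1 2 3 unfolding colon link' \<Delta>_def[symmetric] \<Delta>'_def[symmetric] by blast
qed

end
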